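(* Let $\mathcal{L} \subseteq \mathbb{S}^n$ be a linear subspace, let $C, Y \in \mathbb{S}^n$, and let $\mathcal{S} \subseteq \mathbb{S}^n$ be a subspace whose orthogonal projection $P_{\mathcal{S}} : \mathbb{S}^n \to \mathbb{S}^n$ satisfies the Constraint Set Invariance Conditions for $(C, Y, \mathcal{L})$. Let $$\theta_p := \inf\{ C\cdot X : X \in \mathbb{S}^n_{+} \cap (Y + \mathcal{L})\}, \qquad \theta_d := \sup\{ -Y\cdot S : S \in \mathbb{S}^n_{+} \cap (C + \mathcal{L}^{\perp})\}.$$ Then $$\theta_p = \inf\{ C\cdot X : X \in \mathbb{S}^n_{+} \cap (Y + \mathcal{L}) \cap \mathcal{S}\}, \qquad \theta_d = \sup\{ -Y\cdot S : S \in \mathbb{S}^n_{+} \cap (C + \mathcal{L}^{\perp}) \cap \mathcal{S}\}.$$ Further, $\mathcal{S}$ contains (feasible) points that attain $\theta_p$ and $\theta_d$ when such points exist for the respective original problems.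
   Context: $\mathbb{S}^n$ is the space of real symmetric $n\times n$ matrices with the trace inner product $X\cdot Y := \mathrm{Tr}(XY)$; $\mathbb{S}^n_+$ is the positive semidefinite cone; $\mathcal{L}^\perp$ is the orthogonal complement of $\mathcal{L}$ in $\mathbb{S}^n$; $P_{\mathcal{S}}$ is the orthogonal projection onto $\mathcal{S}$. Infima and suprema are taken in the extended reals. Constraint Set Invariance Conditions: $P_{\mathcal{S}}$ satisfies them if (a) $P_{\mathcal{S}}(\mathbb{S}^n_+)\subseteq \mathbb{S}^n_+$; (b) $P_{\mathcal{S}}(Y+\mathcal{L})\subseteq Y+\mathcal{L}$; (c) $P_{\mathcal{S}}(C+\mathcal{L}^\perp)\subseteq C+\mathcal{L}^\perp$. *)

theory Defs
  imports "HOL-Analysis.Analysis"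
begin

definition sym_mats :: "(real ^ 'n ^ 'n) set" where
  "sym_mats = {A. transpose A = A}"

definition psd_cone :: "(real ^ 'n ^ 'n) set" where
  "psd_cone = {A \<in> sym_mats. \<forall>x. 0 \<le> x \<bullet> (A *v x)}"

definition tr_inner :: "real ^ 'n ^ 'n \<Rightarrow> real ^ 'n ^ 'n \<Rightarrow> real" where
  "tr_inner X Y = trace (X ** Y)"

text \<open>The trace form is an inner product on \<^const>\<open>sym_mats\<close> only, where it is the
  inner product that the type \<^typ>\<open>real ^ 'n ^ 'n\<close> carries anyway.\<close>

lemma tr_inner_eq_inner:
  assumes "Y \<in> sym_mats"
  shows "tr_inner X Y = X \<bullet> Y"
proof -
  have "Y $ j $ i = Y $ i $ j" for i j
    using assms by (simp add: sym_mats_def transpose_def vec_eq_iff)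
  then show ?thesis
    by (simp add: tr_inner_def trace_def matrix_matrix_mult_def inner_vec_def)
qed

text \<open>The complement is taken within \<^const>\<open>sym_mats\<close>; the library's
  \<^const>\<open>orthogonal_comp\<close> would also contain the skew-symmetric matrices.\<close>

definition sym_orth_comp :: "(real ^ 'n ^ 'n) set \<Rightarrow> (real ^ 'n ^ 'n) set" where
  "sym_orth_comp L = {Z \<in> sym_mats. \<forall>X \<in> L. tr_inner X Z = 0}"

definition translate :: "real ^ 'n ^ 'n \<Rightarrow> (real ^ 'n ^ 'n) set \<Rightarrow> (real ^ 'n ^ 'n) set" where
  "translate A V = (\<lambda>X. A + X) ` V"

definition orth_proj :: "(real ^ 'n ^ 'n) set \<Rightarrow> real ^ 'n ^ 'n \<Rightarrow> real ^ 'n ^ 'n" where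
  "orth_proj V X = (THE Z. Z \<in> V \<and> (\<forall>W \<in> V. tr_inner (X - Z) W = 0))"

lemma orth_proj_exists_unique:
  assumes "subspace V" "V \<subseteq> sym_mats"
  shows "\<exists>!Z. Z \<in> V \<and> (\<forall>W \<in> V. tr_inner (X - Z) W = 0)"
proof -
  have tr: "tr_inner A W = A \<bullet> W" if "W \<in> V" for A W
    using that assms(2) by (auto intro: tr_inner_eq_inner)
  obtain y z where yz: "y \<in> span V" "\<And>w. w \<in> span V \<Longrightarrow> orthogonal z w" "X = y + z"
    using orthogonal_subspace_decomp_exists[of V X] by metis
  have sp: "span V = V"
    using assms(1) by (simp add: span_eq_iff)
  show ?thesis
  proof (rule ex1I[of _ y])
    show "y \<in> V \<and> (\<forall>W \<in> V. tr_inner (X - y) W = 0)"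
      using yz sp by (auto simp: tr orthogonal_def)
  next
    fix Z assume Z: "Z \<in> V \<and> (\<forall>W \<in> V. tr_inner (X - Z) W = 0)"
    have d: "Z - y \<in> V"
      using Z yz(1) sp assms(1) by (auto intro: subspace_diff)
    then have "(X - Z) \<bullet> (Z - y) = 0" "(X - y) \<bullet> (Z - y) = 0"
      using Z yz sp tr by (auto simp: orthogonal_def)
    then have "(Z - y) \<bullet> (Z - y) = 0"
      by (simp add: inner_diff_left)
    then show "Z = y"
      by simp
  qed
qed

definition constraint_set_invariance ::
    "(real ^ 'n ^ 'n \<Rightarrow> real ^ 'n ^ 'n) \<Rightarrow> real ^ 'n ^ 'n \<Rightarrow> real ^ 'n ^ 'n \<Rightarrow> (real ^ 'n ^ 'n) set \<Rightarrow> bool" where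
  "constraint_set_invariance P C Y L \<longleftrightarrow>
     P ` psd_cone \<subseteq> psd_cone \<and>
     P ` translate Y L \<subseteq> translate Y L \<and>
     P ` translate C (sym_orth_comp L) \<subseteq> translate C (sym_orth_comp L)"

definition primal_value :: "real ^ 'n ^ 'n \<Rightarrow> real ^ 'n ^ 'n \<Rightarrow> (real ^ 'n ^ 'n) set \<Rightarrow> ereal" where
  "primal_value C Y L = (INF X \<in> psd_cone \<inter> translate Y L. ereal (tr_inner C X))"

definition dual_value :: "real ^ 'n ^ 'n \<Rightarrow> real ^ 'n ^ 'n \<Rightarrow> (real ^ 'n ^ 'n) set \<Rightarrow> ereal" where
  "dual_value C Y L = (SUP S \<in> psd_cone \<inter> translate C (sym_orth_comp L). ereal (- tr_inner Y S))"

end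

(* Let P be the projection onto V and X primal feasible.  By invariance of the affine sets,
   X - P X lies in L and C - P C in its complement, while P C is orthogonal to X - P X; hence
   C . X = C . P X.  So P maps the feasible set into its intersection with V without changing the
   objective, and the two problems take the same set of values.  The dual case exchanges the roles
   of (C, complement of L) and (Y, L). *)

theory Submission
  imports Defs
begin

text \<open>This lets \<open>sym_orth_comp L\<close> stand in the dual problem where
  \<open>L\<close> stands in the primal one.\<close>

lemma subspace_sym_orth_comp: "subspace (sym_orth_comp L)"
proof -
  have "sym_orth_comp L = {Z \<in> sym_mats. \<forall>X \<in> L. X \<bullet> Z = 0}"
    by (auto simp: sym_orth_comp_def tr_inner_eq_inner)
  then show ?thesis
    by (auto simp: subspace_def sym_mats_def transpose_def vec_eq_iff inner_add_right)
qed

lemma mem_translate_iff: "X \<in> translate A V \<longleftrightarrow> X - A \<in> V"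
  by (force simp: translate_def image_iff)

lemma translate_diff:
  assumes "subspace M" "X \<in> translate A M" "Z \<in> translate A M"
  shows "X - Z \<in> M"
  using subspace_diff[OF assms(1), of "X - A" "Z - A"] assms(2,3)
  by (simp add: mem_translate_iff)

text \<open>\<open>X\<close> and its projection lie in the same translate of \<open>M\<close>. To be
  used with \<open>M\<close> equal to \<open>L\<close> and to its complement.\<close>

lemma orth_proj_invariant_diff:
  assumes "subspace M" "orth_proj V ` translate A M \<subseteq> translate A M" "X \<in> translate A M"
  shows "X - orth_proj V X \<in> M"
  using translate_diff[OF assms(1)] assms(2,3) by blast

lemma self_mem_translate: "subspace M \<Longrightarrow> A \<in> translate A M"
  by (simp add: mem_translate_iff subspace_0)

context
  fixes V :: "(real ^ 'n ^ 'n) set"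
  assumes V: "subspace V" "V \<subseteq> sym_mats"
begin

lemma orth_proj_mem: "orth_proj V X \<in> V"
  and orth_proj_inner: "W \<in> V \<Longrightarrow> (X - orth_proj V X) \<bullet> W = 0"
proof -
  have P: "orth_proj V X \<in> V \<and> (\<forall>W \<in> V. tr_inner (X - orth_proj V X) W = 0)"
    unfolding orth_proj_def by (rule theI'[OF orth_proj_exists_unique[OF V]])
  then show "orth_proj V X \<in> V" ..
  assume "W \<in> V"
  with P V(2) show "(X - orth_proj V X) \<bullet> W = 0"
    using tr_inner_eq_inner[of W "X - orth_proj V X"] by auto
qed

text \<open>In the expanded hypothesis the part
  \<open>orth_proj V A \<bullet> (B - orth_proj V B)\<close> vanishes, since
  \<open>B - orth_proj V B\<close> is orthogonal to \<open>V\<close>. What remains is the difference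
  of the two sides.\<close>

lemma inner_orth_proj_eq:
  assumes "(A - orth_proj V A) \<bullet> (B - orth_proj V B) = 0"
  shows "A \<bullet> orth_proj V B = A \<bullet> B"
  using assms orth_proj_inner[OF orth_proj_mem, of B A]
  by (simp add: inner_diff_left inner_diff_right inner_commute)

end

text \<open>Each value \<open>f x\<close> on \<open>F\<close> is also taken at \<open>p x\<close>,
  which lies in \<open>V\<close>.\<close>

lemma image_Int_eq_if_retraction:
  assumes "\<And>x. x \<in> F \<Longrightarrow> p x \<in> F \<inter> V" "\<And>x. x \<in> F \<Longrightarrow> f (p x) = f x"
  shows "f ` (F \<inter> V) = f ` F"
proof
  show "f ` F \<subseteq> f ` (F \<inter> V)"
    using assms by (intro image_subsetI) (metis imageI)
qed auto

theorem proposition2p1: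
  fixes C Y :: "real ^ 'n ^ 'n" and L V :: "(real ^ 'n ^ 'n) set"
  assumes "subspace L" and "L \<subseteq> sym_mats"
    and "C \<in> sym_mats" and "Y \<in> sym_mats"
    and "subspace V" and "V \<subseteq> sym_mats"
    and "constraint_set_invariance (orth_proj V) C Y L"
  shows "primal_value C Y L
           = (INF X \<in> psd_cone \<inter> translate Y L \<inter> V. ereal (tr_inner C X))
         \<and> dual_value C Y L
           = (SUP S \<in> psd_cone \<inter> translate C (sym_orth_comp L) \<inter> V. ereal (- tr_inner Y S))
         \<and> ((\<exists>X \<in> psd_cone \<inter> translate Y L. ereal (tr_inner C X) = primal_value C Y L)
           \<longrightarrow> (\<exists>X \<in> psd_cone \<inter> translate Y L \<inter> V. ereal (tr_inner C X) = primal_value C Y L))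
         \<and> ((\<exists>S \<in> psd_cone \<inter> translate C (sym_orth_comp L).
              ereal (- tr_inner Y S) = dual_value C Y L)
           \<longrightarrow> (\<exists>S \<in> psd_cone \<inter> translate C (sym_orth_comp L) \<inter> V.
              ereal (- tr_inner Y S) = dual_value C Y L))"
proof -
  let ?P = "orth_proj V" and ?M = "sym_orth_comp L"
  have psd: "?P ` psd_cone \<subseteq> psd_cone"
    and inv_Y: "?P ` translate Y L \<subseteq> translate Y L"
    and inv_C: "?P ` translate C ?M \<subseteq> translate C ?M"
    using assms(7) by (auto simp: constraint_set_invariance_def)
  note diff_L = orth_proj_invariant_diff[OF assms(1) inv_Y]
  note diff_M = orth_proj_invariant_diff[OF subspace_sym_orth_comp inv_C]
  have orth: "A \<bullet> B = 0" if "A \<in> L" "B \<in> ?M" for A B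
    using that by (auto simp: sym_orth_comp_def tr_inner_eq_inner)
  \<comment> \<open>Below, this applies to a feasible point and, by \<open>psd\<close>, to its
    projection.\<close>
  have sym: "tr_inner A X = A \<bullet> X" if "X \<in> psd_cone" for A X :: "real ^ 'n ^ 'n"
    using that by (simp add: psd_cone_def tr_inner_eq_inner)
  have primal: "tr_inner C (?P X) = tr_inner C X" if "X \<in> psd_cone \<inter> translate Y L" for X
  proof -
    \<comment> \<open>\<open>C\<close> lies in its own translate \<open>translate C ?M\<close>, so
      \<open>C - ?P C\<close> is in \<open>?M\<close> and hence orthogonal to
      \<open>X - ?P X\<close>, which is in \<open>L\<close>.\<close>
    have "C \<bullet> ?P X = C \<bullet> X"
      using that orth[OF diff_L[of X] diff_M[of C]]
      by (intro inner_orth_proj_eq assms)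
        (simp add: inner_commute self_mem_translate subspace_sym_orth_comp)
    with that psd sym show ?thesis by auto
  qed
  have dual: "tr_inner Y (?P S) = tr_inner Y S" if "S \<in> psd_cone \<inter> translate C ?M" for S
  proof -
    \<comment> \<open>Now \<open>Y - ?P Y\<close> is in \<open>L\<close> and \<open>S - ?P S\<close>
      in \<open>?M\<close>.\<close>
    have "Y \<bullet> ?P S = Y \<bullet> S"
      using that orth[OF diff_L[of Y] diff_M[of S]]
      by (intro inner_orth_proj_eq assms) (simp add: self_mem_translate assms(1))
    with that psd sym show ?thesis by auto
  qed
  have P: "(\<lambda>X. ereal (tr_inner C X)) ` (psd_cone \<inter> translate Y L \<inter> V)
      = (\<lambda>X. ereal (tr_inner C X)) ` (psd_cone \<inter> translate Y L)"
    using psd inv_Y primal orth_proj_mem[OF assms(5,6)]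
    by (intro image_Int_eq_if_retraction[where p = ?P]) auto
  have D: "(\<lambda>S. ereal (- tr_inner Y S)) ` (psd_cone \<inter> translate C ?M \<inter> V)
      = (\<lambda>S. ereal (- tr_inner Y S)) ` (psd_cone \<inter> translate C ?M)"
    using psd inv_C dual orth_proj_mem[OF assms(5,6)]
    by (intro image_Int_eq_if_retraction[where p = ?P]) auto
  \<comment> \<open>Attaining \<open>v\<close> is membership of \<open>v\<close> in the image, so
    \<open>P\<close> and \<open>D\<close> settle attainment as well as the optimal values.\<close>
  have attained: "(\<exists>x\<in>A. f x = v) \<longrightarrow> (\<exists>x\<in>B. f x = v)"
    if "f ` B = f ` A" for f :: "real ^ 'n ^ 'n \<Rightarrow> ereal" and A B v
  proof -
    have "v \<in> f ` A \<longleftrightarrow> v \<in> f ` B" using that by simp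
    then show ?thesis by (auto simp: image_iff)
  qed
  show ?thesis
    using attained[OF P] attained[OF D] by (simp add: P D primal_value_def dual_value_def)
qed

end
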